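(* Let $X\subset\mathbb{R}^d$ be closed and convex, let $\mathbb{X}=(X,\langle\cdot,\cdot\rangle,\xi)$ be a gm-space whose gauge is the Euclidean scalar product, and let $n\in\mathbb{N}$, $n\ge1$. Consider the symmetric positive semi-definite matrix $M_\xi=\int_X xx^\top\,\mathrm{d}\xi(x)\in\mathbb{R}^{d\times d}$. Then $$\sqrt{\lambda_{\min}(M_\xi)}\cdot\mathrm{q}_n^{\mathrm W}(\xi)\le\mathrm{q}_n^{\mathrm{GW}}(\mathbb{X})\le\sqrt{2\lambda_{\max}(M_\xi)}\cdot\mathrm{q}_n^{\mathrm W}(\xi),$$ where $\mathrm{q}_n^{\mathrm W}(\xi)$ is the Wasserstein quantization value with respect to the standard Euclidean metric.
   Context: A gauged measure space (gm-space) is a triple $(X,g,\xi)$ where $X$ is a Polish space, $\xi$ is a Borel probability measure on $X$, and the gauge $g\in L^2(X\times X,\xi\otimes\xi)$ is symmetric. (For $g=\langle\cdot,\cdot\rangle$ on $X\subset\mathbb{R}^d$ this implies that $\xi$ has finite second moment, so that $M_\xi$ and $\mathrm{q}_n^{\mathrm W}(\xi)$ are well-defined.) For gm-spaces $\mathbb{X}=(X,g,\xi)$ and $\mathbb{Y}=(Y,h,\upsilon)$, with $\Pi(\xi,\upsilon)$ the set of couplings of $\xi$ and $\upsilon$, $$\mathrm{GW}_2(\mathbb{X},\mathbb{Y})=\inf_{\pi\in\Pi(\xi,\upsilon)}\Big(\iint_{(X\times Y)^2}|g(x,x')-h(y,y')|^2\,\mathrm{d}\pi(x,y)\,\mathrm{d}\pi(x',y')\Big)^{1/2}.$$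 Write $[n]=\{1,\dots,n\}$. $\mathfrak{GM}_n$ is the set of gm-spaces $([n],G,\upsilon)$ with $G\in\mathbb{R}^{n\times n}$ symmetric (viewed as the gauge $(i,i')\mapsto G_{i,i'}$) and $\upsilon$ a probability measure on $[n]$; $\mathrm{q}_n^{\mathrm{GW}}(\mathbb{X}):=\inf_{\mathbb{Y}\in\mathfrak{GM}_n}\mathrm{GW}_2(\mathbb{X},\mathbb{Y})$. $\mathcal{P}_n(X)=\{\sum_{i=1}^n\upsilon_i\delta_{y_i}:y_i\in X,\ \upsilon_i\ge0,\ \sum_i\upsilon_i=1\}$, $\mathrm{W}_2(\xi,\upsilon)=\inf_{\pi\in\Pi(\xi,\upsilon)}\big(\int\|x-y\|^2\,\mathrm{d}\pi(x,y)\big)^{1/2}$, and $\mathrm{q}_n^{\mathrm W}(\xi):=\inf_{\upsilon\in\mathcal{P}_n(X)}\mathrm{W}_2(\xi,\upsilon)$. $\lambda_{\min}$ and $\lambda_{\max}$ denote the smallest and largest eigenvalue. *)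

theory Defs
  imports "HOL-Probability.Probability"
begin

section \<open>Gauged measure spaces\<close>

definition borel_of :: "'a topology \<Rightarrow> 'a measure" where
  "borel_of T = sigma (topspace T) {U. openin T U}"

definition polish_top :: "'a topology \<Rightarrow> bool" where
  "polish_top T \<longleftrightarrow> completely_metrizable_space T \<and> second_countable T"

definition borel_prob :: "'a topology \<Rightarrow> 'a measure \<Rightarrow> bool" where
  "borel_prob T M \<longleftrightarrow> prob_space M \<and> sets M = sets (borel_of T)"

text \<open>
  A triple \<open>(X, g, \<xi>)\<close>; the underlying set is the \<^const>\<open>topspace\<close> of the topology, and the values
  of the gauge outside of it are irrelevant.
\<close>
type_synonym 'a gm = "'a topology \<times> ('a \<Rightarrow> 'a \<Rightarrow> real) \<times> 'a measure"

fun gm_space :: "'a gm \<Rightarrow> bool" where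
  "gm_space (T, g, \<xi>) \<longleftrightarrow>
     polish_top T \<and> borel_prob T \<xi> \<and>
     (\<forall>x\<in>topspace T. \<forall>x'\<in>topspace T. g x x' = g x' x) \<and>
     (\<lambda>(x, x'). g x x') \<in> borel_measurable (\<xi> \<Otimes>\<^sub>M \<xi>) \<and>
     integrable (\<xi> \<Otimes>\<^sub>M \<xi>) (\<lambda>(x, x'). (g x x')\<^sup>2)"


section \<open>Gromov--Wasserstein and Wasserstein distances\<close>

text \<open>
  Distances and quantization values are taken in \<open>[0,\<infinity>]\<close>, so that no integrability condition is
  needed for them to be meaningful.
\<close>

definition ennreal_sqrt :: "ennreal \<Rightarrow> ennreal" where
  "ennreal_sqrt x = (if x = \<infinity> then \<infinity> else ennreal (sqrt (enn2real x)))"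

definition couplings :: "'a measure \<Rightarrow> 'b measure \<Rightarrow> ('a \<times> 'b) measure set" where
  "couplings \<xi> \<upsilon> =
     {\<pi>. sets \<pi> = sets (\<xi> \<Otimes>\<^sub>M \<upsilon>) \<and> distr \<pi> \<xi> fst = \<xi> \<and> distr \<pi> \<upsilon> snd = \<upsilon>}"

fun GW2 :: "'a gm \<Rightarrow> 'b gm \<Rightarrow> ennreal" where
  "GW2 (S, g, \<xi>) (T, h, \<upsilon>) =
     (INF \<pi>\<in>couplings \<xi> \<upsilon>. ennreal_sqrt
        (\<integral>\<^sup>+(x', y'). (\<integral>\<^sup>+(x, y). ennreal (\<bar>g x x' - h y y'\<bar>\<^sup>2) \<partial>\<pi>) \<partial>\<pi>))"

definition W2 :: "'a::euclidean_space measure \<Rightarrow> 'a measure \<Rightarrow> ennreal" where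
  "W2 \<xi> \<upsilon> =
     (INF \<pi>\<in>couplings \<xi> \<upsilon>. ennreal_sqrt (\<integral>\<^sup>+(x, y). ennreal ((norm (x - y))\<^sup>2) \<partial>\<pi>))"


section \<open>Quantization values\<close>

definition GM :: "nat \<Rightarrow> nat gm set" where
  "GM n = {\<Y>. gm_space \<Y> \<and> (\<exists>G \<upsilon>. \<Y> = (discrete_topology {1..n}, G, \<upsilon>))}"

definition q_GW :: "nat \<Rightarrow> 'a gm \<Rightarrow> ennreal" where
  "q_GW n \<X> = (INF \<Y>\<in>GM n. GW2 \<X> \<Y>)"

text \<open>Measures of the form \<open>\<Sum>i=1..n. w i * \<delta>(y i)\<close>, with possibly repeated points and zero weights.\<close>
definition finite_measures :: "nat \<Rightarrow> 'a topology \<Rightarrow> 'a measure set" where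
  "finite_measures n T =
     {\<upsilon>. sets \<upsilon> = sets (borel_of T) \<and>
        (\<exists>w y. (\<forall>i\<in>{1..n}. 0 \<le> w i \<and> y i \<in> topspace T) \<and> (\<Sum>i=1..n. w i) = 1 \<and>
           (\<forall>A\<in>sets \<upsilon>. emeasure \<upsilon> A =
              (\<Sum>i=1..n. ennreal (w i) * emeasure (return (borel_of T) (y i)) A)))}"

definition q_W :: "nat \<Rightarrow> 'a::euclidean_space topology \<Rightarrow> 'a measure \<Rightarrow> ennreal" where
  "q_W n T \<xi> = (INF \<upsilon>\<in>finite_measures n T. W2 \<xi> \<upsilon>)"


section \<open>Second moment matrix and extremal eigenvalues\<close>

definition moment_matrix :: "(real^'d) measure \<Rightarrow> real^'d^'d" where
  "moment_matrix \<xi> = (\<integral>x. (\<chi> i j. x $ i * x $ j) \<partial>\<xi>)"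

definition eigenvalues :: "real^'d^'d \<Rightarrow> real set" where
  "eigenvalues A = {l. \<exists>v. v \<noteq> 0 \<and> A *v v = l *\<^sub>R v}"

text \<open>
  Only meaningful for matrices with a real eigenvalue, e.g. symmetric ones; the set of eigenvalues
  is always finite.
\<close>
definition lambda_min :: "real^'d^'d \<Rightarrow> real" where
  "lambda_min A = Min (eigenvalues A)"

definition lambda_max :: "real^'d^'d \<Rightarrow> real" where
  "lambda_max A = Max (eigenvalues A)"

end

theory Submission
  imports Defs
begin

text \<open>
  Let \<open>(x, i)\<close> be distributed according to a coupling of \<open>\<xi>\<close> with a measure on the labels \<open>{1..n}\<close>, let \<open>m i\<close>
  be the conditional mean of \<open>x\<close> given the label \<open>i\<close>, and let \<open>r = x - m i\<close> be the residual. A prime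
  denotes an independent copy. Conditionally on \<open>x'\<close> and \<open>i'\<close>, the residual is orthogonal to functions of
  the label \<open>i\<close>. Two consequences carry the proof.

  For the lower bound, no entry \<open>G i i'\<close> of a gauge matrix approximates \<open>x \<bullet> x'\<close> better than \<open>m i \<bullet> x'\<close> does
  when \<open>x'\<close> is known. Hence the Gromov--Wasserstein cost is at least the mean of \<open>(r \<bullet> x')\<^sup>2\<close>, which is
  the mean of \<open>r \<bullet> (M *v r)\<close> for the moment matrix \<open>M\<close> and therefore at least \<open>\<lambda>\<^sub>m\<^sub>i\<^sub>n\<close> times the mean of
  \<open>(norm r)\<^sup>2\<close> (\<open>gauge_cost_ge\<close>). The latter is the cost of transporting \<open>\<xi>\<close> to the law of the
  barycentres, which lie in \<open>X\<close> because \<open>X\<close> is closed and convex.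

  For the upper bound, a transport plan from \<open>\<xi>\<close> to a finitely supported measure labels \<open>x\<close> by the
  atom it is sent to. With the gauge \<open>m i \<bullet> m i'\<close> the error splits into the two orthogonal parts
  \<open>r \<bullet> x'\<close> and \<open>m i \<bullet> r'\<close>, each of mean square at most \<open>\<lambda>\<^sub>m\<^sub>a\<^sub>x\<close> times that of \<open>norm r\<close>
  (\<open>barycentre_gauge_cost_le\<close>), and the conditional mean is at least as close to \<open>x\<close> as the
  atom is (\<open>barycentres_best_approximation\<close>).

  The eigenvalue bounds for the quadratic form come from the Rayleigh quotient
  (\<open>quadratic_form_minimum_eigenvalue\<close>), and the integral defining \<open>M\<close> converges because a square-integrable scalar-product
  gauge forces a finite second moment (\<open>second_moment_finite_if_gauge_square_integrable\<close>).
\<close>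

section \<open>Extremal eigenvalues and quadratic forms\<close>

lemma quadratic_form_line:
  fixes A :: "real^'d^'d"
  assumes sym: "transpose A = A"
  shows "(u + t *\<^sub>R w) \<bullet> (A *v (u + t *\<^sub>R w)) = u \<bullet> (A *v u) + 2 * t * (w \<bullet> (A *v u)) + t\<^sup>2 * (w \<bullet> (A *v w))"
proof -
  have "u \<bullet> (A *v w) = w \<bullet> (A *v u)"
    by (metis dot_lmul_matrix inner_commute sym transpose_matrix_vector)
  then show ?thesis
    by (simp add: matrix_vector_right_distrib matrix_vector_mult_scaleR inner_add_left inner_add_right power2_eq_square algebra_simps)
qed

text \<open>
  Moving from \<open>u\<close> a small distance \<open>s\<close> against \<open>w = A *v u\<close> changes the form by
  \<open>- 2 s (w \<bullet> w)\<close> to first order, so a zero of a nonnegative form that is not in the kernel could be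
  pushed below zero.
\<close>
lemma quadratic_form_kernel:
  fixes A :: "real^'d^'d"
  assumes sym: "transpose A = A" and nonneg: "\<And>v. 0 \<le> v \<bullet> (A *v v)" and null: "u \<bullet> (A *v u) = 0"
  shows "A *v u = 0"
proof (rule ccontr)
  assume "A *v u \<noteq> 0"
  define w where "w = A *v u"
  define a where "a = w \<bullet> w"
  define q where "q = w \<bullet> (A *v w)"
  have a: "a > 0" using \<open>A *v u \<noteq> 0\<close> by (simp add: a_def w_def)
  have q: "q \<ge> 0" using nonneg by (simp add: q_def)
  \<comment> \<open>The minimiser \<open>a / q\<close> of \<open>- 2 s a + s\<^sup>2 q\<close>, with the denominator shifted so that \<open>q = 0\<close> is covered.\<close>
  define s where "s = a / (q + 1)"
  have s: "s > 0" "a = s * (q + 1)" using a q by (auto simp: s_def)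
  have "0 \<le> 2 * (- s) * a + (- s)\<^sup>2 * q"
    using nonneg[of "u + (- s) *\<^sub>R w"] quadratic_form_line[OF sym, of u "- s" w] null
    by (simp add: a_def w_def q_def)
  also have "\<dots> = - (s\<^sup>2 * (q + 2))"
    unfolding s(2) by (simp add: algebra_simps power2_eq_square)
  also have "\<dots> < 0"
    using s q by simp
  finally show False by simp
qed

text \<open>
  Needed because \<^const>\<open>Min\<close> and \<^const>\<open>Max\<close> say nothing about infinite sets. Eigenvectors for distinct
  eigenvalues of a symmetric matrix are orthogonal, hence independent.
\<close>
lemma finite_eigenvalues:
  fixes A :: "real^'d^'d"
  assumes sym: "transpose A = A"
  shows "finite (eigenvalues A)"
proof -
  have "\<forall>l\<in>eigenvalues A. \<exists>v. v \<noteq> 0 \<and> A *v v = l *\<^sub>R v" by (auto simp: eigenvalues_def)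
  then obtain e where e: "\<And>l. l \<in> eigenvalues A \<Longrightarrow> e l \<noteq> 0 \<and> A *v (e l) = l *\<^sub>R e l" by metis
  have orth: "e k \<bullet> e l = 0" if "k \<in> eigenvalues A" "l \<in> eigenvalues A" "k \<noteq> l" for k l
  proof -
    have "k * (e k \<bullet> e l) = (A *v e k) \<bullet> e l" using e that by simp
    also have "\<dots> = e k \<bullet> (A *v e l)"
      by (metis dot_lmul_matrix inner_commute sym transpose_matrix_vector)
    also have "\<dots> = l * (e k \<bullet> e l)" using e that by simp
    finally show ?thesis using that by simp
  qed
  have inj: "inj_on e (eigenvalues A)"
    by (rule inj_onI) (metis e inner_eq_zero_iff orth)
  have "pairwise orthogonal (e ` eigenvalues A)"
    using orth by (auto simp: pairwise_def orthogonal_def)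
  then have "independent (e ` eigenvalues A)"
    by (rule pairwise_orthogonal_independent) (use e in force)
  then show ?thesis
    using independent_imp_finite inj finite_imageD by blast
qed

text \<open>
  The Rayleigh quotient attains its minimum \<open>l\<close> on the compact unit sphere, at \<open>u\<close> say. The form of
  \<open>A - l I\<close> is then nonnegative and vanishes at \<open>u\<close>, so \<open>u\<close> is in the kernel of \<open>A - l I\<close>.
\<close>
lemma quadratic_form_minimum_eigenvalue:
  fixes A :: "real^'d^'d"
  assumes sym: "transpose A = A"
  shows "\<exists>l\<in>eigenvalues A. \<forall>v. l * (norm v)\<^sup>2 \<le> v \<bullet> (A *v v)"
proof -
  define S where "S = sphere (0::real^'d) 1"
  have "compact S" "S \<noteq> {}" by (auto simp: S_def)
  moreover have "continuous_on S (\<lambda>v. v \<bullet> (A *v v))" by (intro continuous_intros)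
  ultimately obtain u where u: "u \<in> S" "\<And>v. v \<in> S \<Longrightarrow> u \<bullet> (A *v u) \<le> v \<bullet> (A *v v)"
    using continuous_attains_inf[of S "\<lambda>v. v \<bullet> (A *v v)"] by blast
  define l where "l = u \<bullet> (A *v u)"
  have ray: "l * (norm v)\<^sup>2 \<le> v \<bullet> (A *v v)" for v
  proof (cases "v = 0")
    case False
    have "l \<le> (v /\<^sub>R norm v) \<bullet> (A *v (v /\<^sub>R norm v))"
      using u(2)[of "v /\<^sub>R norm v"] False by (simp add: l_def S_def)
    also have "\<dots> = (v \<bullet> (A *v v)) / (norm v)\<^sup>2"
      by (simp add: matrix_vector_mult_scaleR power2_eq_square field_simps)
    finally show ?thesis using False by (simp add: field_simps)
  qed simp
  define B where "B = A - l *\<^sub>R mat 1"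
  have Bv: "B *v v = A *v v - l *\<^sub>R v" for v
    by (simp add: B_def matrix_vector_mult_diff_rdistrib scaleR_matrix_vector_assoc[symmetric])
  have "transpose B = B"
    using sym by (simp add: B_def transpose_def vec_eq_iff mat_def)
  moreover have "0 \<le> v \<bullet> (B *v v)" for v
    using ray[of v] by (simp add: Bv inner_diff_right power2_norm_eq_inner)
  moreover have "u \<bullet> (B *v u) = 0"
    using u(1) by (simp add: Bv inner_diff_right l_def S_def dot_square_norm)
  ultimately have "B *v u = 0" by (rule quadratic_form_kernel)
  then have "l \<in> eigenvalues A"
    using u(1) by (auto simp: eigenvalues_def Bv S_def intro!: exI[of _ u])
  with ray show ?thesis by blast
qed

lemma lambda_min_le_quadratic_form:
  fixes A :: "real^'d^'d"
  assumes sym: "transpose A = A"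
  shows "lambda_min A * (norm v)\<^sup>2 \<le> v \<bullet> (A *v v)"
proof -
  obtain l where l: "l \<in> eigenvalues A" "\<And>v. l * (norm v)\<^sup>2 \<le> v \<bullet> (A *v v)"
    using quadratic_form_minimum_eigenvalue[OF sym] by blast
  have "lambda_min A \<le> l"
    unfolding lambda_min_def using finite_eigenvalues[OF sym] l by simp
  then have "lambda_min A * (norm v)\<^sup>2 \<le> l * (norm v)\<^sup>2" by (intro mult_right_mono) auto
  with l(2)[of v] show ?thesis by linarith
qed

lemma quadratic_form_le_lambda_max:
  fixes A :: "real^'d^'d"
  assumes sym: "transpose A = A"
  shows "v \<bullet> (A *v v) \<le> lambda_max A * (norm v)\<^sup>2"
proof -
  have neg: "(- A) *v w = - (A *v w)" for w
    by (simp add: matrix_vector_mult_def vec_eq_iff sum_negf)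
  have "transpose (- A) = - A" using sym by (simp add: transpose_def vec_eq_iff)
  then obtain l where l: "l \<in> eigenvalues (- A)" "\<And>v. l * (norm v)\<^sup>2 \<le> v \<bullet> ((- A) *v v)"
    using quadratic_form_minimum_eigenvalue by blast
  obtain w where "w \<noteq> 0" "- (A *v w) = l *\<^sub>R w" using l(1) by (auto simp: eigenvalues_def neg)
  then have "- l \<in> eigenvalues A"
    by (auto simp: eigenvalues_def intro!: exI[of _ w]) (metis minus_minus)
  then have "- l \<le> lambda_max A"
    unfolding lambda_max_def using finite_eigenvalues[OF sym] by simp
  then have "- l * (norm v)\<^sup>2 \<le> lambda_max A * (norm v)\<^sup>2" by (intro mult_right_mono) auto
  with l(2)[of v] show ?thesis by (simp add: neg)
qed

section \<open>Random vectors with finitely many labels\<close>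

text \<open>
  A coupling of \<open>\<xi>\<close> with a measure on \<open>{1..n}\<close> is a square-integrable random vector \<open>X\<close> together with a
  random label \<open>Y\<close>. Working with random variables instead of measures on a product keeps the
  \<open>\<sigma>\<close>-algebras of the marginals out of the estimates.
\<close>
locale labelled_vector = prob_space P for P :: "'p measure" +
  fixes X :: "'p \<Rightarrow> 'a::euclidean_space" and Y :: "'p \<Rightarrow> nat" and K :: "nat set"
  assumes X_measurable [measurable]: "X \<in> borel_measurable P"
    and Y_measurable [measurable]: "Y \<in> measurable P (count_space K)"
    and finite_K: "finite K"
    and square_integrable: "integrable P (\<lambda>\<omega>. (norm (X \<omega>))\<^sup>2)"
begin

lemma label_in: "\<omega> \<in> space P \<Longrightarrow> Y \<omega> \<in> K"
  using measurable_space[OF Y_measurable] by simp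

lemma label_function_measurable [measurable]:
  fixes f :: "nat \<Rightarrow> 'b::topological_space"
  shows "(\<lambda>\<omega>. f (Y \<omega>)) \<in> borel_measurable P"
  by (rule measurable_compose[OF Y_measurable]) simp

lemma label_function_integrable:
  fixes f :: "nat \<Rightarrow> 'b::euclidean_space"
  shows "integrable P (\<lambda>\<omega>. f (Y \<omega>))"
proof (rule integrable_const_bound)
  show "AE \<omega> in P. norm (f (Y \<omega>)) \<le> (\<Sum>i\<in>K. norm (f i))"
    using finite_K label_in by (intro AE_I2 member_le_sum) auto
qed simp

lemma square_integrable_inner:
  fixes Z W :: "'p \<Rightarrow> 'b::euclidean_space"
  assumes [measurable]: "Z \<in> borel_measurable P" "W \<in> borel_measurable P"
    and "integrable P (\<lambda>\<omega>. (norm (Z \<omega>))\<^sup>2)" "integrable P (\<lambda>\<omega>. (norm (W \<omega>))\<^sup>2)"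
  shows "integrable P (\<lambda>\<omega>. Z \<omega> \<bullet> W \<omega>)"
proof (rule Bochner_Integration.integrable_bound)
  show "integrable P (\<lambda>\<omega>. (norm (Z \<omega>))\<^sup>2 + (norm (W \<omega>))\<^sup>2)" using assms by simp
  show "AE \<omega> in P. norm (Z \<omega> \<bullet> W \<omega>) \<le> norm ((norm (Z \<omega>))\<^sup>2 + (norm (W \<omega>))\<^sup>2)"
  proof (rule AE_I2)
    fix \<omega>
    have "\<bar>Z \<omega> \<bullet> W \<omega>\<bar> \<le> norm (Z \<omega>) * norm (W \<omega>)" by (rule Cauchy_Schwarz_ineq2)
    also have "\<dots> \<le> (norm (Z \<omega>))\<^sup>2 + (norm (W \<omega>))\<^sup>2"
      using sum_squares_bound[of "norm (Z \<omega>)" "norm (W \<omega>)"]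
        mult_nonneg_nonneg[OF norm_ge_zero[of "Z \<omega>"] norm_ge_zero[of "W \<omega>"]]
      unfolding mult.assoc by linarith
    finally show "norm (Z \<omega> \<bullet> W \<omega>) \<le> norm ((norm (Z \<omega>))\<^sup>2 + (norm (W \<omega>))\<^sup>2)" by simp
  qed
qed simp

lemma X_integrable: "integrable P X"
proof (rule Bochner_Integration.integrable_bound)
  show "integrable P (\<lambda>\<omega>. 1 + (norm (X \<omega>))\<^sup>2)" using square_integrable by simp
  show "AE \<omega> in P. norm (X \<omega>) \<le> norm (1 + (norm (X \<omega>))\<^sup>2)"
  proof (rule AE_I2)
    fix \<omega>
    have "2 * norm (X \<omega>) \<le> (norm (X \<omega>))\<^sup>2 + 1"
      using sum_squares_bound[of "norm (X \<omega>)" 1] by simp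
    then have "norm (X \<omega>) \<le> 1 + (norm (X \<omega>))\<^sup>2"
      using norm_ge_zero[of "X \<omega>"] by linarith
    then show "norm (X \<omega>) \<le> norm (1 + (norm (X \<omega>))\<^sup>2)" by simp
  qed
qed simp

definition cell :: "nat \<Rightarrow> 'p set" where "cell i = {\<omega>\<in>space P. Y \<omega> = i}"

lemma cell_measurable [measurable]: "cell i \<in> sets P"
proof -
  have "cell i = Y -` ({i} \<inter> K) \<inter> space P" using label_in by (auto simp: cell_def)
  then show ?thesis using measurable_sets[OF Y_measurable, of "{i} \<inter> K"] by simp
qed

text \<open>
  \<open>m \<circ> Y\<close> is then a version of the conditional expectation of \<open>X\<close> given \<open>Y\<close>. The condition is stated
  without division by the probability of the cell: on a null cell every value of \<open>m\<close> is admitted, which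
  leaves the freedom to place it inside a given convex set.
\<close>
definition barycentres :: "(nat \<Rightarrow> 'a) \<Rightarrow> bool" where
  "barycentres m \<longleftrightarrow> (\<forall>i\<in>K. (\<integral>\<omega>. indicator (cell i) \<omega> *\<^sub>R (X \<omega> - m i) \<partial>P) = 0)"

text \<open>
  A mean value outside of \<open>S\<close> could be strictly separated from \<open>S\<close> by a hyperplane, and integrating the
  separating inequality over the cell would contradict that it is the mean.
\<close>
lemma barycentre_in_closed_convex:
  assumes S: "closed S" "convex S" and XS: "\<And>\<omega>. \<omega> \<in> space P \<Longrightarrow> X \<omega> \<in> S"
  shows "\<exists>c\<in>S. (\<integral>\<omega>. indicator (cell i) \<omega> *\<^sub>R (X \<omega> - c) \<partial>P) = 0"
proof (cases "prob (cell i) = 0")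
  case True
  then have "AE \<omega> in P. \<omega> \<notin> cell i"
    by (simp add: prob_eq_0)
  then have "(\<integral>\<omega>. indicator (cell i) \<omega> *\<^sub>R (X \<omega> - c) \<partial>P) = 0" for c
    by (intro integral_eq_zero_AE) (auto simp: indicator_def)
  then show ?thesis using XS not_empty by blast
next
  case False
  define p where "p = prob (cell i)"
  have p: "p > 0" using False by (simp add: p_def zero_less_measure_iff)
  define c where "c = (\<integral>\<omega>. indicator (cell i) \<omega> *\<^sub>R X \<omega> \<partial>P) /\<^sub>R p"
  have int: "integrable P (\<lambda>\<omega>. indicator (cell i) \<omega> *\<^sub>R X \<omega>)"
    by (intro integrable_mult_indicator X_integrable) simp
  have centre: "(\<integral>\<omega>. indicator (cell i) \<omega> *\<^sub>R (X \<omega> - d) \<partial>P) = p *\<^sub>R (c - d)" for d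
  proof -
    have "(\<integral>\<omega>. indicator (cell i) \<omega> *\<^sub>R (X \<omega> - d) \<partial>P) =
        (\<integral>\<omega>. indicator (cell i) \<omega> *\<^sub>R X \<omega> \<partial>P) - (\<integral>\<omega>. indicator (cell i) \<omega> *\<^sub>R d \<partial>P)"
      unfolding scaleR_diff_right using int
      by (intro Bochner_Integration.integral_diff) (auto intro!: integrable_mult_indicator)
    also have "(\<integral>\<omega>. indicator (cell i) \<omega> *\<^sub>R d \<partial>P) = p *\<^sub>R d"
      by (subst integral_scaleR_left) (auto simp: p_def emeasure_eq_measure intro!: integrable_real_indicator)
    finally show ?thesis using p by (simp add: c_def scaleR_diff_right)
  qed
  have "c \<in> S"
  proof (rule ccontr)
    assume "c \<notin> S"
    then obtain a b where ab: "a \<bullet> c < b" "\<And>x. x \<in> S \<Longrightarrow> b < a \<bullet> x"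
      using separating_hyperplane_closed_point S by metis
    have "0 \<le> (\<integral>\<omega>. a \<bullet> (indicator (cell i) \<omega> *\<^sub>R (X \<omega> - c)) \<partial>P) - (b - a \<bullet> c) * p"
    proof -
      have i2: "integrable P (\<lambda>\<omega>. a \<bullet> (indicator (cell i) \<omega> *\<^sub>R (X \<omega> - c)))"
        by (intro integrable_inner_right integrable_mult_indicator Bochner_Integration.integrable_diff X_integrable) simp_all
      have i1: "integrable P (\<lambda>\<omega>. (b - a \<bullet> c) * indicator (cell i) \<omega>)"
        by (intro integrable_mult_right integrable_real_indicator) (auto simp: emeasure_eq_measure)
      have "(b - a \<bullet> c) * p = (\<integral>\<omega>. (b - a \<bullet> c) * indicator (cell i) \<omega> \<partial>P)"
        by (simp add: p_def)
      also have "\<dots> \<le> (\<integral>\<omega>. a \<bullet> (indicator (cell i) \<omega> *\<^sub>R (X \<omega> - c)) \<partial>P)"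
        by (rule integral_mono[OF i1 i2])
          (use ab(2) XS in \<open>auto simp: indicator_def inner_diff_right less_imp_le\<close>)
      finally show ?thesis by simp
    qed
    also have "(\<integral>\<omega>. a \<bullet> (indicator (cell i) \<omega> *\<^sub>R (X \<omega> - c)) \<partial>P) = 0"
      by (subst integral_inner_right)
        (auto simp: centre intro!: integrable_mult_indicator Bochner_Integration.integrable_diff X_integrable)
    finally have "(b - a \<bullet> c) * p \<le> 0" by simp
    with ab(1) p show False by (simp add: mult_le_0_iff)
  qed
  then show ?thesis using centre[of c] by auto
qed

lemma barycentres_exist:
  assumes S: "closed S" "convex S" and XS: "\<And>\<omega>. \<omega> \<in> space P \<Longrightarrow> X \<omega> \<in> S"
  shows "\<exists>m. barycentres m \<and> range m \<subseteq> S"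
proof -
  obtain m where "\<And>i. m i \<in> S \<and> (\<integral>\<omega>. indicator (cell i) \<omega> *\<^sub>R (X \<omega> - m i) \<partial>P) = 0"
    using barycentre_in_closed_convex[OF assms] by metis
  then show ?thesis unfolding barycentres_def by blast
qed

lemma residual_square_integrable:
  "integrable P (\<lambda>\<omega>. (norm (X \<omega> - f (Y \<omega>)))\<^sup>2)"
proof -
  have "(norm (X \<omega> - f (Y \<omega>)))\<^sup>2 = (norm (X \<omega>))\<^sup>2 - 2 * (X \<omega> \<bullet> f (Y \<omega>)) + (norm (f (Y \<omega>)))\<^sup>2" for \<omega>
    by (simp add: power2_norm_eq_inner inner_diff_left inner_diff_right inner_commute)
  moreover have "integrable P (\<lambda>\<omega>. X \<omega> \<bullet> f (Y \<omega>))"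
    using label_function_integrable[of "\<lambda>i. (norm (f i))\<^sup>2"] square_integrable
    by (intro square_integrable_inner) auto
  ultimately show ?thesis
    using square_integrable label_function_integrable[of "\<lambda>i. (norm (f i))\<^sup>2"] by simp
qed

text \<open>
  The residual \<open>X - m \<circ> Y\<close> is orthogonal to every vector-valued function of the label, because it
  has mean zero on each cell. Both Pythagorean identities below are instances.
\<close>
lemma residual_orthogonal:
  assumes "barycentres m"
  shows "(\<integral>\<omega>. (X \<omega> - m (Y \<omega>)) \<bullet> f (Y \<omega>) \<partial>P) = 0"
proof -
  have int: "integrable P (\<lambda>\<omega>. indicator (cell i) \<omega> *\<^sub>R (X \<omega> - m i))" for i
    by (intro integrable_mult_indicator Bochner_Integration.integrable_diff X_integrable) auto
  have "(\<integral>\<omega>. (X \<omega> - m (Y \<omega>)) \<bullet> f (Y \<omega>) \<partial>P)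
      = (\<integral>\<omega>. (\<Sum>i\<in>K. (indicator (cell i) \<omega> *\<^sub>R (X \<omega> - m i)) \<bullet> f i) \<partial>P)"
  proof (rule Bochner_Integration.integral_cong[OF refl])
    fix \<omega> assume w: "\<omega> \<in> space P"
    have "(\<Sum>i\<in>K. (indicator (cell i) \<omega> *\<^sub>R (X \<omega> - m i)) \<bullet> f i) =
        (\<Sum>i\<in>K. if i = Y \<omega> then (X \<omega> - m i) \<bullet> f i else 0)"
      by (intro sum.cong) (auto simp: cell_def indicator_def w)
    then show "(X \<omega> - m (Y \<omega>)) \<bullet> f (Y \<omega>) =
        (\<Sum>i\<in>K. (indicator (cell i) \<omega> *\<^sub>R (X \<omega> - m i)) \<bullet> f i)"
      using finite_K label_in[OF w] by simp
  qed
  also have "\<dots> = (\<Sum>i\<in>K. (\<integral>\<omega>. (indicator (cell i) \<omega> *\<^sub>R (X \<omega> - m i)) \<bullet> f i \<partial>P))"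
    by (intro Bochner_Integration.integral_sum integrable_inner_left int)
  also have "\<dots> = (\<Sum>i\<in>K. (\<integral>\<omega>. indicator (cell i) \<omega> *\<^sub>R (X \<omega> - m i) \<partial>P) \<bullet> f i)"
    by (intro sum.cong refl integral_inner_left int)
  also have "\<dots> = 0" using assms by (simp add: barycentres_def)
  finally show ?thesis .
qed

lemma pythagoras_vector:
  assumes "barycentres m"
  shows "(\<integral>\<omega>. (norm (X \<omega> - f (Y \<omega>)))\<^sup>2 \<partial>P) =
    (\<integral>\<omega>. (norm (X \<omega> - m (Y \<omega>)))\<^sup>2 \<partial>P) + (\<integral>\<omega>. (norm (m (Y \<omega>) - f (Y \<omega>)))\<^sup>2 \<partial>P)"
proof -
  have [measurable]: "(\<lambda>\<omega>. m (Y \<omega>) - f (Y \<omega>)) \<in> borel_measurable P"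
    using label_function_measurable[of "\<lambda>i. m i - f i"] .
  have sq: "integrable P (\<lambda>\<omega>. (norm (m (Y \<omega>) - f (Y \<omega>)))\<^sup>2)"
    using label_function_integrable[of "\<lambda>i. (norm (m i - f i))\<^sup>2"] .
  have cr: "integrable P (\<lambda>\<omega>. (X \<omega> - m (Y \<omega>)) \<bullet> (m (Y \<omega>) - f (Y \<omega>)))"
    by (intro square_integrable_inner residual_square_integrable sq) auto
  have "(norm (X \<omega> - f (Y \<omega>)))\<^sup>2 = (norm (X \<omega> - m (Y \<omega>)))\<^sup>2 +
      2 * ((X \<omega> - m (Y \<omega>)) \<bullet> (m (Y \<omega>) - f (Y \<omega>))) + (norm (m (Y \<omega>) - f (Y \<omega>)))\<^sup>2" for \<omega>
    by (simp add: power2_norm_eq_inner inner_diff_left inner_diff_right inner_commute)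
  then show ?thesis
    using residual_orthogonal[OF assms, of "\<lambda>i. m i - f i"] cr sq residual_square_integrable[of m]
    by simp
qed

lemma residual_inner_square_integrable:
  "integrable P (\<lambda>\<omega>. (v \<bullet> X \<omega> - f (Y \<omega>))\<^sup>2)"
proof (rule Bochner_Integration.integrable_bound)
  show "integrable P (\<lambda>\<omega>. 2 * ((norm v)\<^sup>2 * (norm (X \<omega>))\<^sup>2) + 2 * (f (Y \<omega>))\<^sup>2)"
    using label_function_integrable[of "\<lambda>i. (f i)\<^sup>2"] square_integrable by simp
  show "AE \<omega> in P. norm ((v \<bullet> X \<omega> - f (Y \<omega>))\<^sup>2)
      \<le> norm (2 * ((norm v)\<^sup>2 * (norm (X \<omega>))\<^sup>2) + 2 * (f (Y \<omega>))\<^sup>2)"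
  proof (rule AE_I2)
    fix \<omega>
    have "(v \<bullet> X \<omega>)\<^sup>2 \<le> (norm v)\<^sup>2 * (norm (X \<omega>))\<^sup>2"
      using Cauchy_Schwarz_ineq[of v "X \<omega>"] by (simp add: power2_norm_eq_inner)
    moreover have "(v \<bullet> X \<omega> - f (Y \<omega>))\<^sup>2 \<le> 2 * (v \<bullet> X \<omega>)\<^sup>2 + 2 * (f (Y \<omega>))\<^sup>2"
      using sum_squares_bound[of "v \<bullet> X \<omega>" "- f (Y \<omega>)"] by (simp add: power2_diff)
    ultimately show "norm ((v \<bullet> X \<omega> - f (Y \<omega>))\<^sup>2)
      \<le> norm (2 * ((norm v)\<^sup>2 * (norm (X \<omega>))\<^sup>2) + 2 * (f (Y \<omega>))\<^sup>2)" by simp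
  qed
qed simp

text \<open>
  This is applied with \<open>v = X \<omega>'\<close> for a fixed second point \<open>\<omega>'\<close> and with \<open>f\<close> a row of the gauge matrix. The
  cross term vanishes by taking the function of the label that multiplies \<open>v\<close> by the scalar
  \<open>v \<bullet> m i - f i\<close>.
\<close>
lemma pythagoras_inner:
  assumes "barycentres m"
  shows "(\<integral>\<omega>. (v \<bullet> X \<omega> - f (Y \<omega>))\<^sup>2 \<partial>P) =
    (\<integral>\<omega>. (v \<bullet> (X \<omega> - m (Y \<omega>)))\<^sup>2 \<partial>P) + (\<integral>\<omega>. (v \<bullet> m (Y \<omega>) - f (Y \<omega>))\<^sup>2 \<partial>P)"
proof -
  define h where "h i = (v \<bullet> m i - f i) *\<^sub>R v" for i
  have [measurable]: "(\<lambda>\<omega>. h (Y \<omega>)) \<in> borel_measurable P" by (rule label_function_measurable)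
  have cr: "integrable P (\<lambda>\<omega>. (X \<omega> - m (Y \<omega>)) \<bullet> h (Y \<omega>))"
    using label_function_integrable[of "\<lambda>i. (norm (h i))\<^sup>2"]
    by (intro square_integrable_inner residual_square_integrable) auto
  have "(v \<bullet> X \<omega> - f (Y \<omega>))\<^sup>2 = (v \<bullet> (X \<omega> - m (Y \<omega>)))\<^sup>2 +
      2 * ((X \<omega> - m (Y \<omega>)) \<bullet> h (Y \<omega>)) + (v \<bullet> m (Y \<omega>) - f (Y \<omega>))\<^sup>2" for \<omega>
    by (simp add: h_def inner_diff_left inner_diff_right inner_commute power2_eq_square algebra_simps)
  moreover have "integrable P (\<lambda>\<omega>. (v \<bullet> (X \<omega> - m (Y \<omega>)))\<^sup>2)"
    using residual_inner_square_integrable[of v "\<lambda>i. v \<bullet> m i"] by (simp add: inner_diff_right)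
  moreover have "integrable P (\<lambda>\<omega>. (v \<bullet> m (Y \<omega>) - f (Y \<omega>))\<^sup>2)"
    using label_function_integrable[of "\<lambda>i. (v \<bullet> m i - f i)\<^sup>2"] .
  ultimately show ?thesis
    using residual_orthogonal[OF assms, of h] cr by simp
qed

lemma nn_integral_residual_inner:
  "(\<integral>\<^sup>+\<omega>. ennreal ((v \<bullet> X \<omega> - f (Y \<omega>))\<^sup>2) \<partial>P) = ennreal (\<integral>\<omega>. (v \<bullet> X \<omega> - f (Y \<omega>))\<^sup>2 \<partial>P)"
  by (intro nn_integral_eq_integral residual_inner_square_integrable) simp

text \<open>
  By Tonelli the squared products of independent copies of \<open>X\<close> and \<open>R\<close> integrate to the second-moment
  form of \<open>X\<close> evaluated at \<open>R\<close>; this is where the eigenvalues of the moment matrix enter.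
\<close>
lemma nn_integral_swap_inner:
  assumes [measurable]: "R \<in> borel_measurable P"
  shows "(\<integral>\<^sup>+\<omega>'. (\<integral>\<^sup>+\<omega>. ennreal ((X \<omega>' \<bullet> R \<omega>)\<^sup>2) \<partial>P) \<partial>P) = (\<integral>\<^sup>+\<omega>. ennreal (\<integral>\<omega>'. (R \<omega> \<bullet> X \<omega>')\<^sup>2 \<partial>P) \<partial>P)"
proof -
  interpret pair_sigma_finite P P ..
  have "(\<integral>\<^sup>+\<omega>'. (\<integral>\<^sup>+\<omega>. ennreal ((X \<omega>' \<bullet> R \<omega>)\<^sup>2) \<partial>P) \<partial>P) = (\<integral>\<^sup>+\<omega>. (\<integral>\<^sup>+\<omega>'. ennreal ((X \<omega>' \<bullet> R \<omega>)\<^sup>2) \<partial>P) \<partial>P)"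
    by (rule Fubini') measurable
  also have "\<dots> = (\<integral>\<^sup>+\<omega>. ennreal (\<integral>\<omega>'. (R \<omega> \<bullet> X \<omega>')\<^sup>2 \<partial>P) \<partial>P)"
    using nn_integral_residual_inner[of _ "\<lambda>_. 0"] by (simp add: inner_commute)
  finally show ?thesis .
qed

text \<open>
  For each fixed second point \<open>\<omega>'\<close> the best approximation of \<open>X \<bullet> X \<omega>'\<close> by a function of \<open>Y\<close> is
  \<open>m (Y) \<bullet> X \<omega>'\<close>, whatever the matrix \<open>G\<close> is. What remains is the second-moment form of
  \<open>X\<close> at the residual, and the hypothesis on the form bounds it from below.
\<close>
lemma gauge_cost_ge:
  assumes m: "barycentres m" and "0 \<le> a"
    and form: "\<And>v. a * (norm v)\<^sup>2 \<le> (\<integral>\<omega>. (v \<bullet> X \<omega>)\<^sup>2 \<partial>P)"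
  shows "ennreal a * (\<integral>\<^sup>+\<omega>. ennreal ((norm (X \<omega> - m (Y \<omega>)))\<^sup>2) \<partial>P)
    \<le> (\<integral>\<^sup>+\<omega>'. (\<integral>\<^sup>+\<omega>. ennreal ((X \<omega> \<bullet> X \<omega>' - G (Y \<omega>) (Y \<omega>'))\<^sup>2) \<partial>P) \<partial>P)"
proof -
  let ?R = "\<lambda>\<omega>. X \<omega> - m (Y \<omega>)"
  have "ennreal a * (\<integral>\<^sup>+\<omega>. ennreal ((norm (?R \<omega>))\<^sup>2) \<partial>P) = (\<integral>\<^sup>+\<omega>. ennreal (a * (norm (?R \<omega>))\<^sup>2) \<partial>P)"
    using \<open>0 \<le> a\<close> by (subst nn_integral_cmult[symmetric]) (auto simp: ennreal_mult)
  also have "\<dots> \<le> (\<integral>\<^sup>+\<omega>. ennreal (\<integral>\<omega>'. (?R \<omega> \<bullet> X \<omega>')\<^sup>2 \<partial>P) \<partial>P)"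
    by (intro nn_integral_mono ennreal_leI form)
  also have "\<dots> = (\<integral>\<^sup>+\<omega>'. (\<integral>\<^sup>+\<omega>. ennreal ((X \<omega>' \<bullet> ?R \<omega>)\<^sup>2) \<partial>P) \<partial>P)"
    by (rule nn_integral_swap_inner[symmetric]) measurable
  also have "\<dots> \<le> (\<integral>\<^sup>+\<omega>'. (\<integral>\<^sup>+\<omega>. ennreal ((X \<omega> \<bullet> X \<omega>' - G (Y \<omega>) (Y \<omega>'))\<^sup>2) \<partial>P) \<partial>P)"
  proof (rule nn_integral_mono)
    fix \<omega>'
    have "(\<integral>\<omega>. (X \<omega>' \<bullet> ?R \<omega>)\<^sup>2 \<partial>P) \<le> (\<integral>\<omega>. (X \<omega>' \<bullet> X \<omega> - G (Y \<omega>) (Y \<omega>'))\<^sup>2 \<partial>P)"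
      using pythagoras_inner[OF m, of "X \<omega>'" "\<lambda>i. G i (Y \<omega>')"] by simp
    then show "(\<integral>\<^sup>+\<omega>. ennreal ((X \<omega>' \<bullet> ?R \<omega>)\<^sup>2) \<partial>P) \<le> (\<integral>\<^sup>+\<omega>. ennreal ((X \<omega> \<bullet> X \<omega>' - G (Y \<omega>) (Y \<omega>'))\<^sup>2) \<partial>P)"
      using nn_integral_residual_inner[of "X \<omega>'" "\<lambda>i. G i (Y \<omega>')"]
        nn_integral_residual_inner[of "X \<omega>'" "\<lambda>i. X \<omega>' \<bullet> m i"]
      by (simp add: inner_diff_right inner_commute ennreal_leI)
  qed
  finally show ?thesis .
qed

text \<open>
  Write \<open>R = X - m \<circ> Y\<close> and let a prime denote the second copy. Then
  \<open>X \<bullet> X' - m(Y) \<bullet> m(Y') = R \<bullet> X' + m(Y) \<bullet> R'\<close>, and the two summands are orthogonal by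
  \<open>pythagoras_inner\<close>. The square of the first integrates to the second-moment form of \<open>X\<close> at \<open>R\<close>, the
  square of the second to the form of \<open>m \<circ> Y\<close> at \<open>R'\<close>, which is at most that of \<open>X\<close> since passing to
  conditional means lowers second moments. Each of them contributes a factor \<open>b\<close>, whence \<open>2 * b\<close>.
\<close>
lemma barycentre_gauge_cost_le:
  assumes m: "barycentres m" and "0 \<le> b"
    and form: "\<And>v. (\<integral>\<omega>. (v \<bullet> X \<omega>)\<^sup>2 \<partial>P) \<le> b * (norm v)\<^sup>2"
  shows "(\<integral>\<^sup>+\<omega>'. (\<integral>\<^sup>+\<omega>. ennreal ((X \<omega> \<bullet> X \<omega>' - m (Y \<omega>) \<bullet> m (Y \<omega>'))\<^sup>2) \<partial>P) \<partial>P)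
    \<le> ennreal (2 * b) * (\<integral>\<^sup>+\<omega>. ennreal ((norm (X \<omega> - m (Y \<omega>)))\<^sup>2) \<partial>P)"
proof -
  let ?R = "\<lambda>\<omega>. X \<omega> - m (Y \<omega>)"
  have "(\<integral>\<^sup>+\<omega>. ennreal ((X \<omega> \<bullet> X \<omega>' - m (Y \<omega>) \<bullet> m (Y \<omega>'))\<^sup>2) \<partial>P)
      \<le> (\<integral>\<^sup>+\<omega>. ennreal ((X \<omega>' \<bullet> ?R \<omega>)\<^sup>2) \<partial>P) + ennreal (b * (norm (?R \<omega>'))\<^sup>2)" for \<omega>'
  proof -
    have "(\<integral>\<omega>. (X \<omega>' \<bullet> m (Y \<omega>) - m (Y \<omega>) \<bullet> m (Y \<omega>'))\<^sup>2 \<partial>P) = (\<integral>\<omega>. (?R \<omega>' \<bullet> m (Y \<omega>))\<^sup>2 \<partial>P)"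
      by (simp add: inner_diff_left inner_commute[of "m (Y \<omega>')"])
    also have "\<dots> \<le> (\<integral>\<omega>. (?R \<omega>' \<bullet> X \<omega>)\<^sup>2 \<partial>P)"
      using pythagoras_inner[OF m, of "?R \<omega>'" "\<lambda>_. 0"] by simp
    also have "\<dots> \<le> b * (norm (?R \<omega>'))\<^sup>2" by (rule form)
    finally have "(\<integral>\<omega>. (X \<omega>' \<bullet> X \<omega> - m (Y \<omega>) \<bullet> m (Y \<omega>'))\<^sup>2 \<partial>P)
        \<le> (\<integral>\<omega>. (X \<omega>' \<bullet> ?R \<omega>)\<^sup>2 \<partial>P) + b * (norm (?R \<omega>'))\<^sup>2"
      using pythagoras_inner[OF m, of "X \<omega>'" "\<lambda>i. m i \<bullet> m (Y \<omega>')"] by simp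
    then have "ennreal (\<integral>\<omega>. (X \<omega>' \<bullet> X \<omega> - m (Y \<omega>) \<bullet> m (Y \<omega>'))\<^sup>2 \<partial>P)
        \<le> ennreal (\<integral>\<omega>. (X \<omega>' \<bullet> ?R \<omega>)\<^sup>2 \<partial>P) + ennreal (b * (norm (?R \<omega>'))\<^sup>2)"
      using \<open>0 \<le> b\<close> by (simp add: ennreal_leI flip: ennreal_plus)
    then show ?thesis
      using nn_integral_residual_inner[of "X \<omega>'" "\<lambda>i. m i \<bullet> m (Y \<omega>')"]
        nn_integral_residual_inner[of "X \<omega>'" "\<lambda>i. X \<omega>' \<bullet> m i"]
      by (simp add: inner_diff_right inner_commute)
  qed
  then have "(\<integral>\<^sup>+\<omega>'. (\<integral>\<^sup>+\<omega>. ennreal ((X \<omega> \<bullet> X \<omega>' - m (Y \<omega>) \<bullet> m (Y \<omega>'))\<^sup>2) \<partial>P) \<partial>P)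
     \<le> (\<integral>\<^sup>+\<omega>'. (\<integral>\<^sup>+\<omega>. ennreal ((X \<omega>' \<bullet> ?R \<omega>)\<^sup>2) \<partial>P) + ennreal (b * (norm (?R \<omega>'))\<^sup>2) \<partial>P)"
    by (intro nn_integral_mono)
  also have "\<dots> = (\<integral>\<^sup>+\<omega>'. (\<integral>\<^sup>+\<omega>. ennreal ((X \<omega>' \<bullet> ?R \<omega>)\<^sup>2) \<partial>P) \<partial>P) + (\<integral>\<^sup>+\<omega>'. ennreal (b * (norm (?R \<omega>'))\<^sup>2) \<partial>P)"
    by (rule nn_integral_add) measurable
  also have "(\<integral>\<^sup>+\<omega>'. (\<integral>\<^sup>+\<omega>. ennreal ((X \<omega>' \<bullet> ?R \<omega>)\<^sup>2) \<partial>P) \<partial>P) = (\<integral>\<^sup>+\<omega>. ennreal (\<integral>\<omega>'. (?R \<omega> \<bullet> X \<omega>')\<^sup>2 \<partial>P) \<partial>P)"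
    by (rule nn_integral_swap_inner) measurable
  also have "\<dots> \<le> (\<integral>\<^sup>+\<omega>. ennreal (b * (norm (?R \<omega>))\<^sup>2) \<partial>P)"
    by (intro nn_integral_mono ennreal_leI form)
  also have "(\<integral>\<^sup>+\<omega>. ennreal (b * (norm (?R \<omega>))\<^sup>2) \<partial>P) + (\<integral>\<^sup>+\<omega>. ennreal (b * (norm (?R \<omega>))\<^sup>2) \<partial>P)
      = ennreal (2 * b) * (\<integral>\<^sup>+\<omega>. ennreal ((norm (?R \<omega>))\<^sup>2) \<partial>P)"
  proof -
    have "(\<integral>\<^sup>+\<omega>. ennreal (b * (norm (?R \<omega>))\<^sup>2) \<partial>P) = ennreal b * (\<integral>\<^sup>+\<omega>. ennreal ((norm (?R \<omega>))\<^sup>2) \<partial>P)"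
      using \<open>0 \<le> b\<close> by (subst nn_integral_cmult[symmetric]) (auto simp: ennreal_mult)
    moreover have "ennreal (2 * b) = ennreal b + ennreal b"
      using \<open>0 \<le> b\<close> by (simp flip: ennreal_plus)
    ultimately show ?thesis by (simp only: distrib_right)
  qed
  finally show ?thesis by (simp add: add_right_mono)
qed

lemma barycentres_best_approximation:
  assumes "barycentres m"
  shows "(\<integral>\<^sup>+\<omega>. ennreal ((norm (X \<omega> - m (Y \<omega>)))\<^sup>2) \<partial>P) \<le> (\<integral>\<^sup>+\<omega>. ennreal ((norm (X \<omega> - f (Y \<omega>)))\<^sup>2) \<partial>P)"
  using pythagoras_vector[OF assms, of f]
  by (simp add: nn_integral_eq_integral[OF residual_square_integrable] ennreal_leI)

end

section \<open>Square roots and scaled infima\<close>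

lemma ennreal_sqrt_mono:
  assumes "x \<le> y" shows "ennreal_sqrt x \<le> ennreal_sqrt y"
  using assms by (cases x; cases y) (auto simp: ennreal_sqrt_def top_unique)

text \<open>The convention \<open>0 * \<top> = 0\<close> makes this true for \<open>a = 0\<close> and \<open>x = \<top>\<close> as well.\<close>
lemma ennreal_sqrt_mult:
  assumes "0 \<le> a"
  shows "ennreal (sqrt a) * ennreal_sqrt x = ennreal_sqrt (ennreal a * x)"
proof (cases x)
  case (real r)
  then show ?thesis using assms
    by (simp add: ennreal_sqrt_def real_sqrt_mult flip: ennreal_mult)
next
  case top
  then show ?thesis using assms
    by (cases "a = 0") (simp_all add: ennreal_sqrt_def ennreal_mult_top)
qed

text \<open>
  Nonemptiness matters when \<open>c = 0\<close>: the infimum over the empty set is \<open>\<top>\<close>, and \<open>0 * \<top> = 0\<close>.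
\<close>
lemma le_ennreal_mult_INF:
  fixes c q :: ennreal
  assumes "A \<noteq> {}" and "c \<noteq> \<top>" and le: "\<And>a. a \<in> A \<Longrightarrow> q \<le> c * f a"
  shows "q \<le> c * (INF a\<in>A. f a)"
proof (cases "c = 0")
  case True
  then show ?thesis using assms by auto
next
  case False
  have "q / c \<le> f a" if "a \<in> A" for a
    using le[OF that] False \<open>c \<noteq> \<top>\<close>
    by (metis divide_le_posI_ennreal mult.commute not_gr_zero)
  then have "q / c \<le> (INF a\<in>A. f a)" by (rule INF_greatest)
  then have "c * (q / c) \<le> c * (INF a\<in>A. f a)" by (rule mult_left_mono) simp
  moreover have "c * (q / c) = q"
    using False \<open>c \<noteq> \<top>\<close> by (metis ennreal_mult_divide_eq ennreal_times_divide mult.commute)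
  ultimately show ?thesis by simp
qed

section \<open>Borel sets and couplings\<close>

lemma space_borel_of: "space (borel_of T) = topspace T"
  unfolding borel_of_def by (rule space_measure_of) (auto dest: openin_subset)

lemma openin_in_sets_borel_of: "openin T U \<Longrightarrow> U \<in> sets (borel_of T)"
  unfolding borel_of_def by (subst sets_measure_of) (auto dest: openin_subset)

lemma borel_measurable_inclusion:
  assumes "sets M = sets (borel_of (top_of_set X))"
  shows "(\<lambda>x. x) \<in> borel_measurable M"
proof (rule borel_measurableI)
  fix S :: "'a set" assume "open S"
  have "space M = X" using sets_eq_imp_space_eq[OF assms] by (simp add: space_borel_of)
  then have "(\<lambda>x. x) -` S \<inter> space M = X \<inter> S" by auto
  then show "(\<lambda>x. x) -` S \<inter> space M \<in> sets M"
    using \<open>open S\<close> by (auto simp: assms intro!: openin_in_sets_borel_of openin_open_Int)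
qed

lemma sets_borel_of_discrete: "sets (borel_of (discrete_topology A)) = Pow A"
  using sets.sets_into_space[of _ "borel_of (discrete_topology A)"]
  by (auto simp: space_borel_of intro!: openin_in_sets_borel_of)

lemma coupling_measurable:
  assumes "\<pi> \<in> couplings \<xi> \<upsilon>"
  shows "fst \<in> measurable \<pi> \<xi>" "snd \<in> measurable \<pi> \<upsilon>"
proof -
  have "sets \<pi> = sets (\<xi> \<Otimes>\<^sub>M \<upsilon>)" using assms by (simp add: couplings_def)
  then show "fst \<in> measurable \<pi> \<xi>" "snd \<in> measurable \<pi> \<upsilon>"
    by (simp_all cong: measurable_cong_sets)
qed

lemma coupling_prob_space:
  assumes "prob_space \<xi>" "\<pi> \<in> couplings \<xi> \<upsilon>"
  shows "prob_space \<pi>"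
  using prob_space_distrD[OF coupling_measurable(1)[OF assms(2)]] assms
  by (simp add: couplings_def)

lemma coupling_image:
  assumes \<pi>: "\<pi> \<in> couplings \<xi> \<upsilon>" and f: "f \<in> measurable \<upsilon> N"
  shows "(\<lambda>p. (fst p, f (snd p))) \<in> measurable \<pi> (\<xi> \<Otimes>\<^sub>M distr \<upsilon> N f)" (is ?m)
    and "distr \<pi> (\<xi> \<Otimes>\<^sub>M distr \<upsilon> N f) (\<lambda>p. (fst p, f (snd p))) \<in> couplings \<xi> (distr \<upsilon> N f)" (is ?c)
proof -
  note [measurable] = coupling_measurable[OF \<pi>] f
  show m [measurable]: ?m by measurable
  have "distr \<pi> \<xi> fst = \<xi>" "distr \<pi> \<upsilon> snd = \<upsilon>" using \<pi> by (auto simp: couplings_def)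
  moreover have "distr \<pi> (distr \<upsilon> N f) (\<lambda>p. f (snd p)) = distr (distr \<pi> \<upsilon> snd) N f"
    using f by (subst distr_distr) (auto simp: comp_def coupling_measurable[OF \<pi>] intro: distr_cong)
  ultimately show ?c
    by (simp add: couplings_def distr_distr comp_def)
qed

lemma couplings_nonempty:
  assumes "prob_space \<xi>" "prob_space \<upsilon>"
  shows "couplings \<xi> \<upsilon> \<noteq> {}"
proof -
  interpret x: prob_space \<xi> by fact
  interpret u: prob_space \<upsilon> by fact
  have "distr (\<xi> \<Otimes>\<^sub>M \<upsilon>) \<upsilon> snd = \<upsilon>"
  proof (rule measure_eqI)
    fix A assume "A \<in> sets (distr (\<xi> \<Otimes>\<^sub>M \<upsilon>) \<upsilon> snd)"
    then have A: "A \<in> sets \<upsilon>" by simp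
    have "snd -` A \<inter> space (\<xi> \<Otimes>\<^sub>M \<upsilon>) = space \<xi> \<times> A"
      using sets.sets_into_space[OF A] by (auto simp: space_pair_measure)
    then show "emeasure (distr (\<xi> \<Otimes>\<^sub>M \<upsilon>) \<upsilon> snd) A = emeasure \<upsilon> A"
      using A by (simp add: emeasure_distr u.emeasure_pair_measure_Times x.emeasure_space_1)
  qed simp
  then have "\<xi> \<Otimes>\<^sub>M \<upsilon> \<in> couplings \<xi> \<upsilon>"
    by (simp add: couplings_def u.distr_pair_fst)
  then show ?thesis by blast
qed

section \<open>Finitely supported measures\<close>

lemma finite_measures_prob_space:
  assumes "\<nu> \<in> finite_measures n T"
  shows "prob_space \<nu>"
proof
  obtain w y where sets: "sets \<nu> = sets (borel_of T)" and
    wy: "\<forall>i\<in>{1..n}. 0 \<le> w i \<and> y i \<in> topspace T" "(\<Sum>i=1..n. w i) = 1"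
    "\<forall>A\<in>sets \<nu>. emeasure \<nu> A = (\<Sum>i=1..n. ennreal (w i) * emeasure (return (borel_of T) (y i)) A)"
    using assms unfolding finite_measures_def by blast
  have sp: "space \<nu> = topspace T" using sets_eq_imp_space_eq[OF sets] by (simp add: space_borel_of)
  have "emeasure \<nu> (space \<nu>) = (\<Sum>i=1..n. ennreal (w i) * emeasure (return (borel_of T) (y i)) (space \<nu>))"
    using wy(3) by simp
  also have "\<dots> = (\<Sum>i=1..n. ennreal (w i))"
    using wy(1) sets.top[of \<nu>] by (intro sum.cong) (auto simp: sp sets)
  also have "\<dots> = 1" using wy by (subst sum_ennreal) auto
  finally show "emeasure \<nu> (space \<nu>) = 1" .
qed

text \<open>
  The lower bound turns an arbitrary measure on labels into a competitor for the Wasserstein problem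
  by sending each label to its barycentre.
\<close>
lemma label_law_image_in_finite_measures:
  assumes "prob_space \<upsilon>" and sets: "sets \<upsilon> = Pow {1..n}" and m: "\<And>i. i \<in> {1..n} \<Longrightarrow> m i \<in> topspace T"
  shows "m \<in> measurable \<upsilon> (borel_of T)" and "distr \<upsilon> (borel_of T) m \<in> finite_measures n T"
proof -
  interpret prob_space \<upsilon> by fact
  have sp: "space \<upsilon> = {1..n}" using sets_eq_imp_space_eq[of \<upsilon> "count_space {1..n}"] sets by simp
  show m' [measurable]: "m \<in> measurable \<upsilon> (borel_of T)"
    using m by (auto simp: measurable_def sets sp space_borel_of)
  have "(\<Sum>i=1..n. prob {i}) = 1"
    using finite_measure_eq_sum_singleton[of "{1..n}"] prob_space by (simp add: sp sets)
  moreover have "emeasure (distr \<upsilon> (borel_of T) m) A =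
      (\<Sum>i=1..n. ennreal (prob {i}) * emeasure (return (borel_of T) (m i)) A)"
    if A: "A \<in> sets (borel_of T)" for A
  proof -
    have "emeasure (distr \<upsilon> (borel_of T) m) A = emeasure \<upsilon> (m -` A \<inter> {1..n})"
      using A by (simp add: emeasure_distr sp)
    also have "\<dots> = (\<Sum>i\<in>m -` A \<inter> {1..n}. emeasure \<upsilon> {i})"
      by (rule emeasure_eq_sum_singleton) (auto simp: sets)
    also have "\<dots> = (\<Sum>i=1..n. ennreal (prob {i}) * emeasure (return (borel_of T) (m i)) A)"
      using A by (intro sum.mono_neutral_cong_left) (auto simp: emeasure_eq_measure indicator_def split: if_splits)
    finally show ?thesis .
  qed
  ultimately show "distr \<upsilon> (borel_of T) m \<in> finite_measures n T"
    using m unfolding finite_measures_def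
    by (auto intro!: exI[of _ "\<lambda>i. prob {i}"] exI[of _ m])
qed

text \<open>
  The points of a finitely supported measure may be repeated, so a transport plan to it does not
  determine which index an atom belongs to. A measurable choice \<open>t\<close> of one index for each point repairs
  this; the resulting label law may differ from the original weights, but its image under \<open>y\<close> is the
  same measure. Points other than the atoms \<open>y i\<close> with \<open>i \<in> {1..n}\<close> get the index \<open>1\<close>.
\<close>
lemma finite_measure_labelling:
  assumes \<nu>: "\<nu> \<in> finite_measures n (top_of_set (X :: 'a::euclidean_space set))" and "n \<ge> 1"
  obtains y t where "t \<in> measurable \<nu> (count_space {1..n})" "AE z in \<nu>. y (t z) = z"
proof -
  obtain w y where sets: "sets \<nu> = sets (borel_of (top_of_set X))" and
    em: "\<forall>A\<in>sets \<nu>. emeasure \<nu> A = (\<Sum>i=1..n. ennreal (w i) * emeasure (return (borel_of (top_of_set X)) (y i)) A)"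
    using \<nu> unfolding finite_measures_def by blast
  have [measurable]: "(\<lambda>z. z) \<in> borel_measurable \<nu>" by (rule borel_measurable_inclusion[OF sets])
  define F where "F = y ` {1..n}"
  have fin: "space \<nu> \<inter> B \<in> sets \<nu>" if "finite B" for B
  proof -
    have "(\<lambda>z. z) -` B \<inter> space \<nu> \<in> sets \<nu>"
      using that by (intro measurable_sets[of _ _ borel]) (auto intro!: borel_closed finite_imp_closed)
    then show ?thesis by (simp add: Int_commute vimage_def)
  qed
  have "\<exists>i\<in>{1..n}. z \<in> F \<longrightarrow> y i = z" for z
  proof (cases "z \<in> F")
    case True
    then show ?thesis by (auto simp: F_def)
  next
    case False
    then show ?thesis using \<open>n \<ge> 1\<close> by (intro bexI[of _ 1]) auto
  qed
  then obtain s where s: "\<And>z. s z \<in> {1..n} \<and> (z \<in> F \<longrightarrow> y (s z) = z)" by metis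
  define t where "t z = (if z \<in> F then s z else 1)" for z
  have "t \<in> measurable \<nu> (count_space {1..n})"
  proof (subst measurable_count_space_eq2)
    show "t \<in> space \<nu> \<rightarrow> {1..n} \<and> (\<forall>a\<in>{1..n}. t -` {a} \<inter> space \<nu> \<in> sets \<nu>)"
    proof (intro conjI ballI)
      fix a
      have "t -` {a} \<inter> space \<nu> =
          space \<nu> \<inter> {z\<in>F. s z = a} \<union> (if a = 1 then space \<nu> - space \<nu> \<inter> F else {})"
        by (auto simp: t_def split: if_splits)
      also have "\<dots> \<in> sets \<nu>"
        by (intro sets.Un fin) (auto simp: F_def intro!: sets.Diff fin)
      finally show "t -` {a} \<inter> space \<nu> \<in> sets \<nu>" .
    qed (use s \<open>n \<ge> 1\<close> in \<open>auto simp: t_def\<close>)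
  qed simp
  moreover have "AE z in \<nu>. y (t z) = z"
  proof (rule AE_I)
    show N: "space \<nu> - space \<nu> \<inter> F \<in> sets \<nu>" by (intro sets.Diff fin) (auto simp: F_def)
    show "emeasure \<nu> (space \<nu> - space \<nu> \<inter> F) = 0"
      using N sets by (subst bspec[OF em N]) (auto simp: F_def indicator_def)
    show "{z \<in> space \<nu>. \<not> y (t z) = z} \<subseteq> space \<nu> - space \<nu> \<inter> F"
      using s by (auto simp: t_def)
  qed
  ultimately show thesis by (rule that)
qed

lemma GM_member:
  assumes "prob_space \<upsilon>" and sets: "sets \<upsilon> = Pow {1..n}" and sym: "\<And>i j. G i j = G j i"
  shows "(discrete_topology {1..n}, G, \<upsilon>) \<in> GM n"
proof -
  interpret prob_space \<upsilon> by fact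
  interpret pp: pair_prob_space \<upsilon> \<upsilon> ..
  have sp: "space \<upsilon> = {1..n}" using sets_eq_imp_space_eq[of \<upsilon> "count_space {1..n}"] sets by simp
  have "sets (\<upsilon> \<Otimes>\<^sub>M \<upsilon>) = sets (count_space {1..n} \<Otimes>\<^sub>M count_space {1..n})"
    by (rule sets_pair_measure_cong) (simp_all add: sets)
  also have "\<dots> = sets (count_space ({1..n} \<times> {1..n}))"
    by (subst pair_measure_count_space) simp_all
  finally have s2: "sets (\<upsilon> \<Otimes>\<^sub>M \<upsilon>) = sets (count_space ({1..n} \<times> {1..n}))" .
  have meas: "h \<in> borel_measurable (\<upsilon> \<Otimes>\<^sub>M \<upsilon>)" for h :: "nat \<times> nat \<Rightarrow> real"
    by (subst measurable_cong_sets[OF s2 refl]) simp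
  have "integrable (\<upsilon> \<Otimes>\<^sub>M \<upsilon>) (\<lambda>(x, x'). (G x x')\<^sup>2)"
  proof (rule pp.integrable_const_bound)
    show "AE p in \<upsilon> \<Otimes>\<^sub>M \<upsilon>. norm (case p of (x, x') \<Rightarrow> (G x x')\<^sup>2)
        \<le> (\<Sum>p\<in>{1..n}\<times>{1..n}. case p of (x, x') \<Rightarrow> (G x x')\<^sup>2)"
    proof (rule AE_I2)
      fix p assume "p \<in> space (\<upsilon> \<Otimes>\<^sub>M \<upsilon>)"
      then have "p \<in> {1..n} \<times> {1..n}" by (simp add: space_pair_measure sp)
      then have "(case p of (x, x') \<Rightarrow> (G x x')\<^sup>2) \<le> (\<Sum>p\<in>{1..n}\<times>{1..n}. case p of (x, x') \<Rightarrow> (G x x')\<^sup>2)"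
        by (intro member_le_sum) auto
      then show "norm (case p of (x, x') \<Rightarrow> (G x x')\<^sup>2)
        \<le> (\<Sum>p\<in>{1..n}\<times>{1..n}. case p of (x, x') \<Rightarrow> (G x x')\<^sup>2)"
        by (cases p) simp
    qed
  qed (rule meas)
  then show ?thesis
    using assms meas
    by (auto simp: GM_def polish_top_def borel_prob_def sets_borel_of_discrete
        completely_metrizable_space_discrete_topology second_countable_discrete_topology)
qed

section \<open>Second moments\<close>

text \<open>
  The vectors \<open>v\<close> for which \<open>(v \<bullet> x)\<^sup>2\<close> is integrable form a subspace \<open>V\<close>. By Fubini almost every
  point \<open>x\<close> lies in \<open>V\<close>, and for such \<open>x\<close> the squared norm is the finite sum of the integrable
  functions \<open>(b \<bullet> x)\<^sup>2\<close> over an orthonormal basis of \<open>V\<close>.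
\<close>
lemma second_moment_finite_if_gauge_square_integrable:
  fixes M :: "'a::euclidean_space measure"
  assumes "prob_space M" and [measurable]: "(\<lambda>x. x) \<in> borel_measurable M"
    and gauge: "integrable (M \<Otimes>\<^sub>M M) (\<lambda>(x, x'). (x \<bullet> x')\<^sup>2)"
  shows "integrable M (\<lambda>x. (norm x)\<^sup>2)"
proof -
  interpret prob_space M by fact
  interpret pair_sigma_finite M M ..
  define V where "V = {v. integrable M (\<lambda>x. (v \<bullet> x)\<^sup>2)}"
  have [measurable]: "(\<lambda>x. v \<bullet> x) \<in> borel_measurable M" for v
    by (rule borel_measurable_inner) measurable
  have "subspace V"
    unfolding subspace_def
  proof (intro conjI ballI allI)
    show "0 \<in> V" by (simp add: V_def)
    fix v w assume "v \<in> V" "w \<in> V"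
    show "v + w \<in> V"
      unfolding V_def mem_Collect_eq
    proof (rule Bochner_Integration.integrable_bound)
      show "integrable M (\<lambda>x. 2 * (v \<bullet> x)\<^sup>2 + 2 * (w \<bullet> x)\<^sup>2)"
        using \<open>v \<in> V\<close> \<open>w \<in> V\<close> by (simp add: V_def)
      have "((v + w) \<bullet> x)\<^sup>2 \<le> 2 * (v \<bullet> x)\<^sup>2 + 2 * (w \<bullet> x)\<^sup>2" for x
        using sum_squares_bound[of "v \<bullet> x" "w \<bullet> x"] by (simp add: inner_add_left power2_sum)
      then show "AE x in M. norm (((v + w) \<bullet> x)\<^sup>2) \<le> norm (2 * (v \<bullet> x)\<^sup>2 + 2 * (w \<bullet> x)\<^sup>2)"
        by (intro AE_I2) simp
    qed simp
  next
    fix c v assume "v \<in> V"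
    then show "c *\<^sub>R v \<in> V" by (simp add: V_def power_mult_distrib)
  qed
  obtain B where B: "B \<subseteq> V" "pairwise orthogonal B" "\<And>b. b \<in> B \<Longrightarrow> norm b = 1"
    "independent B" "span B = V"
    using orthonormal_basis_subspace[OF \<open>subspace V\<close>] by metis
  have finB: "finite B" using B(4) by (rule independent_imp_finite)
  have norm_eq: "(norm x)\<^sup>2 = (\<Sum>b\<in>B. (b \<bullet> x)\<^sup>2)" if "x \<in> V" for x
  proof -
    have "(\<Sum>b\<in>B. (b \<bullet> x) *\<^sub>R b) = x"
      using orthonormal_basis_expand[OF B(2,3) _ finB, of x] B(5) that
      by (simp add: inner_commute)
    then have "x \<bullet> x = x \<bullet> (\<Sum>b\<in>B. (b \<bullet> x) *\<^sub>R b)" by simp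
    also have "\<dots> = (\<Sum>b\<in>B. (b \<bullet> x)\<^sup>2)"
      by (simp add: inner_sum_right power2_eq_square inner_commute)
    finally show ?thesis by (simp add: power2_norm_eq_inner)
  qed
  have "AE x in M. x \<in> V"
    using AE_integrable_fst'[OF gauge] by (simp add: V_def)
  then have "AE x in M. (\<Sum>b\<in>B. (b \<bullet> x)\<^sup>2) = (norm x)\<^sup>2"
    by eventually_elim (simp add: norm_eq)
  moreover have "integrable M (\<lambda>x. \<Sum>b\<in>B. (b \<bullet> x)\<^sup>2)"
    using B(1) by (intro Bochner_Integration.integrable_sum) (auto simp: V_def)
  ultimately show ?thesis
    by (rule integrable_cong_AE_imp[rotated 2]) measurable
qed

text \<open>
  Square integrability of the norm makes the matrix-valued integrand Bochner integrable, so that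
  linear maps such as transposition and \<open>A \<mapsto> v \<bullet> (A *v v)\<close> commute with the integral.
\<close>
lemma
  fixes \<xi> :: "(real^'d) measure"
  assumes [measurable]: "(\<lambda>x. x) \<in> borel_measurable \<xi>" and sq: "integrable \<xi> (\<lambda>x. (norm x)\<^sup>2)"
  shows moment_matrix_symmetric: "transpose (moment_matrix \<xi>) = moment_matrix \<xi>"
    and moment_matrix_quadratic_form: "v \<bullet> (moment_matrix \<xi> *v v) = (\<integral>x. (v \<bullet> x)\<^sup>2 \<partial>\<xi>)"
proof -
  let ?f = "\<lambda>x::real^'d. \<chi> i j. x $ i * x $ j"
  have "?f \<in> borel_measurable borel"
    by (intro borel_measurable_continuous_onI continuous_intros)
  then have [measurable]: "?f \<in> borel_measurable \<xi>"
    using measurable_compose[OF assms(1)] by blast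
  have "norm (?f x) \<le> real CARD('d) * real CARD('d) * (norm x)\<^sup>2" for x
  proof -
    have "norm (?f x) \<le> (\<Sum>i\<in>UNIV. norm (?f x $ i))" by (simp add: norm_vec_def L2_set_le_sum)
    also have "\<dots> \<le> (\<Sum>i\<in>(UNIV::'d set). real CARD('d) * (norm x)\<^sup>2)"
    proof (rule sum_mono)
      fix i
      have "norm (?f x $ i) \<le> (\<Sum>j\<in>UNIV. \<bar>?f x $ i $ j\<bar>)" by (rule norm_le_l1_cart)
      also have "\<dots> \<le> (\<Sum>j\<in>(UNIV::'d set). (norm x)\<^sup>2)"
        by (intro sum_mono) (simp add: abs_mult power2_eq_square mult_mono component_le_norm_cart)
      finally show "norm (?f x $ i) \<le> real CARD('d) * (norm x)\<^sup>2" by simp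
    qed
    finally show ?thesis by simp
  qed
  moreover have "integrable \<xi> (\<lambda>x. real CARD('d) * real CARD('d) * (norm x)\<^sup>2)"
    using sq by simp
  ultimately have int: "integrable \<xi> ?f"
    by (intro Bochner_Integration.integrable_bound[of \<xi>
          "\<lambda>x. real CARD('d) * real CARD('d) * (norm x)\<^sup>2" ?f])
      (auto intro!: AE_I2 simp: abs_mult)
  have "linear (transpose :: real^'d^'d \<Rightarrow> _)"
    by (rule linearI) (simp_all add: transpose_def vec_eq_iff)
  then show "transpose (moment_matrix \<xi>) = moment_matrix \<xi>"
    unfolding moment_matrix_def
    by (subst integral_bounded_linear[OF _ int, symmetric])
      (auto simp: linear_conv_bounded_linear transpose_def mult.commute)
  have "linear (\<lambda>A :: real^'d^'d. v \<bullet> (A *v v))"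
    by (rule linearI)
      (simp_all add: matrix_vector_mult_add_rdistrib inner_add_right scaleR_matrix_vector_assoc[symmetric])
  moreover have "v \<bullet> (?f x *v v) = (v \<bullet> x)\<^sup>2" for x
    by (simp add: inner_vec_def matrix_vector_mult_def power2_eq_square sum_distrib_left sum_distrib_right ac_simps)
  ultimately show "v \<bullet> (moment_matrix \<xi> *v v) = (\<integral>x. (v \<bullet> x)\<^sup>2 \<partial>\<xi>)"
    unfolding moment_matrix_def
    by (subst integral_bounded_linear[OF _ int, symmetric])
      (auto simp: linear_conv_bounded_linear)
qed

section \<open>Comparison of the quantization values\<close>

lemma GW2_cost_eq:
  "(\<integral>\<^sup>+(x', y'). (\<integral>\<^sup>+(x, y). ennreal (\<bar>x \<bullet> x' - h y y'\<bar>\<^sup>2) \<partial>\<pi>) \<partial>\<pi>) =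
   (\<integral>\<^sup>+p'. (\<integral>\<^sup>+p. ennreal ((fst p \<bullet> fst p' - h (snd p) (snd p'))\<^sup>2) \<partial>\<pi>) \<partial>\<pi>)"
  by (simp add: case_prod_unfold)

locale scalar_product_gm_space =
  fixes X :: "(real^'d) set" and \<xi> :: "(real^'d) measure"
  assumes gm: "gm_space (top_of_set X, inner, \<xi>)"
begin

lemma sets_\<xi>: "sets \<xi> = sets (borel_of (top_of_set X))"
  and prob_space_\<xi>: "prob_space \<xi>"
  using gm by (auto simp: borel_prob_def)

lemma space_\<xi>: "space \<xi> = X"
  using sets_eq_imp_space_eq[OF sets_\<xi>] by (simp add: space_borel_of)

lemma inclusion_measurable [measurable]: "(\<lambda>x. x) \<in> borel_measurable \<xi>"
  by (rule borel_measurable_inclusion[OF sets_\<xi>])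

lemma second_moment_finite: "integrable \<xi> (\<lambda>x. (norm x)\<^sup>2)"
  using gm by (intro second_moment_finite_if_gauge_square_integrable prob_space_\<xi> inclusion_measurable) simp

lemma lambda_bounds:
  "lambda_min (moment_matrix \<xi>) * (norm v)\<^sup>2 \<le> (\<integral>x. (v \<bullet> x)\<^sup>2 \<partial>\<xi>)"
  "(\<integral>x. (v \<bullet> x)\<^sup>2 \<partial>\<xi>) \<le> lambda_max (moment_matrix \<xi>) * (norm v)\<^sup>2"
  using lambda_min_le_quadratic_form quadratic_form_le_lambda_max
    moment_matrix_symmetric[OF inclusion_measurable second_moment_finite]
  by (simp_all flip: moment_matrix_quadratic_form[OF inclusion_measurable second_moment_finite])

lemma lambda_max_nonneg: "0 \<le> lambda_max (moment_matrix \<xi>)"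
proof -
  obtain v :: "real^'d" where "norm v = 1" using vector_choose_size[of 1] by auto
  have "0 \<le> (\<integral>x. (v \<bullet> x)\<^sup>2 \<partial>\<xi>)" by simp
  also have "\<dots> \<le> lambda_max (moment_matrix \<xi>)" using lambda_bounds(2)[of v] \<open>norm v = 1\<close> by simp
  finally show ?thesis .
qed

lemma coupling_labelled_vector:
  assumes \<pi>: "\<pi> \<in> couplings \<xi> \<upsilon>" and sets: "sets \<upsilon> = Pow {1..n}"
  shows "labelled_vector \<pi> fst snd {1..n}"
    and "(\<integral>p. (v \<bullet> fst p)\<^sup>2 \<partial>\<pi>) = (\<integral>x. (v \<bullet> x)\<^sup>2 \<partial>\<xi>)"
proof -
  note [measurable] = coupling_measurable[OF \<pi>]
  have fst: "distr \<pi> \<xi> fst = \<xi>" using \<pi> by (simp add: couplings_def)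
  interpret prob_space \<pi> by (rule coupling_prob_space[OF prob_space_\<xi> \<pi>])
  have X: "fst \<in> borel_measurable \<pi>"
    using measurable_compose[OF coupling_measurable(1)[OF \<pi>] inclusion_measurable] by simp
  have "sets \<upsilon> = sets (count_space {1..n})" by (simp add: sets)
  then have Y: "snd \<in> measurable \<pi> (count_space {1..n})"
    using coupling_measurable(2)[OF \<pi>] measurable_cong_sets by blast
  have "integrable (distr \<pi> \<xi> fst) (\<lambda>x. (norm x)\<^sup>2)" by (simp add: fst second_moment_finite)
  then have "integrable \<pi> (\<lambda>p. (norm (fst p))\<^sup>2)"
    by (subst (asm) integrable_distr_eq) measurable
  with X Y show "labelled_vector \<pi> fst snd {1..n}"
    by unfold_locales auto
  have "(\<integral>x. (v \<bullet> x)\<^sup>2 \<partial>distr \<pi> \<xi> fst) = (\<integral>p. (v \<bullet> fst p)\<^sup>2 \<partial>\<pi>)"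
    by (rule integral_distr) measurable
  then show "(\<integral>p. (v \<bullet> fst p)\<^sup>2 \<partial>\<pi>) = (\<integral>x. (v \<bullet> x)\<^sup>2 \<partial>\<xi>)" by (simp add: fst)
qed

text \<open>
  Convexity and closedness of \<open>X\<close> put the barycentres into \<open>X\<close>, so that the law of \<open>m \<circ> snd\<close> under
  the coupling is admissible for the Wasserstein quantization problem.
\<close>
lemma q_W_le_GW2:
  assumes "closed X" "convex X"
    and Y: "gm_space (discrete_topology {1..n}, G, \<upsilon>)"
  shows "ennreal (sqrt (lambda_min (moment_matrix \<xi>))) * q_W n (top_of_set X) \<xi>
    \<le> GW2 (top_of_set X, inner, \<xi>) (discrete_topology {1..n}, G, \<upsilon>)"
  unfolding GW2.simps GW2_cost_eq
proof (rule INF_greatest)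
  fix \<pi> assume \<pi>: "\<pi> \<in> couplings \<xi> \<upsilon>"
  let ?l = "lambda_min (moment_matrix \<xi>)"
  let ?cost = "\<integral>\<^sup>+p'. (\<integral>\<^sup>+p. ennreal ((fst p \<bullet> fst p' - G (snd p) (snd p'))\<^sup>2) \<partial>\<pi>) \<partial>\<pi>"
  have u: "prob_space \<upsilon>" "sets \<upsilon> = Pow {1..n}"
    using Y by (auto simp: borel_prob_def sets_borel_of_discrete)
  interpret labelled_vector \<pi> fst snd "{1..n}" by (rule coupling_labelled_vector(1)[OF \<pi> u(2)])
  show "ennreal (sqrt ?l) * q_W n (top_of_set X) \<xi> \<le> ennreal_sqrt ?cost"
  proof (cases "0 \<le> ?l")
    case False
    \<comment> \<open>The factor is then the image of a negative real in \<open>[0,\<infinity>]\<close>, that is, \<open>0\<close>.\<close>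
    then show ?thesis by (simp add: ennreal_neg)
  next
    case True
    have "fst p \<in> X" if "p \<in> space \<pi>" for p
      using measurable_space[OF coupling_measurable(1)[OF \<pi>] that] by (simp add: space_\<xi>)
    then obtain m where m: "barycentres m" "range m \<subseteq> X"
      using barycentres_exist[OF assms(1,2)] by blast
    have mX: "m i \<in> topspace (top_of_set X)" for i using m(2) by auto
    note im = label_law_image_in_finite_measures[OF u, of m "top_of_set X", OF mX]
    define \<nu> where "\<nu> = distr \<upsilon> (borel_of (top_of_set X)) m"
    note [measurable] = coupling_image(1)[OF \<pi> im(1), folded \<nu>_def]
    have c: "distr \<pi> (\<xi> \<Otimes>\<^sub>M \<nu>) (\<lambda>p. (fst p, m (snd p))) \<in> couplings \<xi> \<nu>"
      using coupling_image(2)[OF \<pi> im(1)] by (simp add: \<nu>_def)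
    have [measurable]: "(\<lambda>x. x) \<in> borel_measurable \<nu>"
      by (rule borel_measurable_inclusion[of _ X]) (simp add: \<nu>_def)
    have "q_W n (top_of_set X) \<xi> \<le> W2 \<xi> \<nu>"
      unfolding q_W_def using im(2) by (auto simp: \<nu>_def intro: INF_lower)
    also have "\<dots> \<le> ennreal_sqrt (\<integral>\<^sup>+(x, y). ennreal ((norm (x - y))\<^sup>2)
        \<partial>distr \<pi> (\<xi> \<Otimes>\<^sub>M \<nu>) (\<lambda>p. (fst p, m (snd p))))"
      unfolding W2_def by (rule INF_lower[OF c])
    also have "\<dots> = ennreal_sqrt (\<integral>\<^sup>+p. ennreal ((norm (fst p - m (snd p)))\<^sup>2) \<partial>\<pi>)"
      by (subst nn_integral_distr) (simp_all add: split_beta)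
    finally have "ennreal (sqrt ?l) * q_W n (top_of_set X) \<xi>
        \<le> ennreal (sqrt ?l) * ennreal_sqrt (\<integral>\<^sup>+p. ennreal ((norm (fst p - m (snd p)))\<^sup>2) \<partial>\<pi>)"
      by (rule mult_left_mono) simp
    also have "\<dots> = ennreal_sqrt (ennreal ?l * (\<integral>\<^sup>+p. ennreal ((norm (fst p - m (snd p)))\<^sup>2) \<partial>\<pi>))"
      by (rule ennreal_sqrt_mult[OF True])
    also have "\<dots> \<le> ennreal_sqrt ?cost"
      using lambda_bounds(1)
      by (intro ennreal_sqrt_mono gauge_cost_ge m True) (simp add: coupling_labelled_vector(2)[OF \<pi> u(2)])
    finally show ?thesis .
  qed
qed

text \<open>
  The gauge matrix is the Gram matrix of the barycentres, taken after the plan has been moved to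
  labels. Their optimality among functions of the label brings the cost back to that of
  the given plan.
\<close>
lemma q_GW_le_transport_cost:
  assumes "n \<ge> 1" and \<nu>: "\<nu> \<in> finite_measures n (top_of_set X)" and \<pi>: "\<pi> \<in> couplings \<xi> \<nu>"
  shows "q_GW n (top_of_set X, inner, \<xi>)
    \<le> ennreal (sqrt (2 * lambda_max (moment_matrix \<xi>)))
        * ennreal_sqrt (\<integral>\<^sup>+(x, y). ennreal ((norm (x - y))\<^sup>2) \<partial>\<pi>)"
proof -
  let ?l = "lambda_max (moment_matrix \<xi>)"
  obtain y t where t: "t \<in> measurable \<nu> (count_space {1..n})" and yt: "AE z in \<nu>. y (t z) = z"
    using finite_measure_labelling[OF \<nu> \<open>n \<ge> 1\<close>] by blast
  interpret \<nu>: prob_space \<nu> by (rule finite_measures_prob_space[OF \<nu>])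
  define \<upsilon> where "\<upsilon> = distr \<nu> (count_space {1..n}) t"
  have u: "prob_space \<upsilon>" "sets \<upsilon> = Pow {1..n}"
    using \<nu>.prob_space_distr[OF t] by (simp_all add: \<upsilon>_def)
  define \<rho> where "\<rho> = distr \<pi> (\<xi> \<Otimes>\<^sub>M \<upsilon>) (\<lambda>p. (fst p, t (snd p)))"
  have \<rho>: "\<rho> \<in> couplings \<xi> \<upsilon>"
    using coupling_image(2)[OF \<pi> t] by (simp add: \<rho>_def \<upsilon>_def)
  interpret labelled_vector \<rho> fst snd "{1..n}" by (rule coupling_labelled_vector(1)[OF \<rho> u(2)])
  obtain m where m: "barycentres m"
    using barycentres_exist[OF closed_UNIV convex_UNIV] by blast
  have "q_GW n (top_of_set X, inner, \<xi>)
      \<le> GW2 (top_of_set X, inner, \<xi>) (discrete_topology {1..n}, \<lambda>i j. m i \<bullet> m j, \<upsilon>)"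
    unfolding q_GW_def by (rule INF_lower) (rule GM_member[OF u], rule inner_commute)
  also have "\<dots> \<le> ennreal_sqrt (\<integral>\<^sup>+p'. (\<integral>\<^sup>+p. ennreal ((fst p \<bullet> fst p' - m (snd p) \<bullet> m (snd p'))\<^sup>2) \<partial>\<rho>) \<partial>\<rho>)"
    unfolding GW2.simps GW2_cost_eq by (rule INF_lower[OF \<rho>])
  also have "\<dots> \<le> ennreal_sqrt (ennreal (2 * ?l) * (\<integral>\<^sup>+p. ennreal ((norm (fst p - m (snd p)))\<^sup>2) \<partial>\<rho>))"
    using lambda_bounds(2)
    by (intro ennreal_sqrt_mono barycentre_gauge_cost_le m lambda_max_nonneg)
      (simp add: coupling_labelled_vector(2)[OF \<rho> u(2)])
  also have "\<dots> \<le> ennreal_sqrt (ennreal (2 * ?l) * (\<integral>\<^sup>+p. ennreal ((norm (fst p - y (snd p)))\<^sup>2) \<partial>\<rho>))"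
    by (intro ennreal_sqrt_mono mult_left_mono barycentres_best_approximation m) simp
  also have "(\<integral>\<^sup>+p. ennreal ((norm (fst p - y (snd p)))\<^sup>2) \<partial>\<rho>)
      = (\<integral>\<^sup>+p. ennreal ((norm (fst p - y (t (snd p))))\<^sup>2) \<partial>\<pi>)"
  proof -
    have "(\<lambda>p. ennreal ((norm (fst p - y (snd p)))\<^sup>2)) \<in> borel_measurable \<rho>" by measurable
    then have "(\<lambda>p. ennreal ((norm (fst p - y (snd p)))\<^sup>2)) \<in> borel_measurable (\<xi> \<Otimes>\<^sub>M \<upsilon>)"
      by (simp add: \<rho>_def)
    then show ?thesis
      unfolding \<rho>_def using coupling_image(1)[OF \<pi> t]
      by (subst nn_integral_distr) (simp_all add: \<upsilon>_def)
  qed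
  also have "\<dots> = (\<integral>\<^sup>+(x, z). ennreal ((norm (x - z))\<^sup>2) \<partial>\<pi>)"
  proof (rule nn_integral_cong_AE)
    have "distr \<pi> \<nu> snd = \<nu>" using \<pi> by (simp add: couplings_def)
    with yt have "AE z in distr \<pi> \<nu> snd. y (t z) = z" by metis
    then have "AE p in \<pi>. y (t (snd p)) = snd p"
      by (rule AE_distrD[OF coupling_measurable(2)[OF \<pi>]])
    then show "AE p in \<pi>. ennreal ((norm (fst p - y (t (snd p))))\<^sup>2) = (case p of (x, z) \<Rightarrow> ennreal ((norm (x - z))\<^sup>2))"
      by eventually_elim (simp add: split_beta)
  qed
  also have "ennreal_sqrt (ennreal (2 * ?l) * \<dots>) = ennreal (sqrt (2 * ?l)) * ennreal_sqrt \<dots>"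
    using lambda_max_nonneg by (simp add: ennreal_sqrt_mult)
  finally show ?thesis .
qed

lemma finite_measures_nonempty:
  assumes "n \<ge> 1"
  shows "finite_measures n (top_of_set X) \<noteq> {}"
proof -
  interpret prob_space \<xi> by (rule prob_space_\<xi>)
  obtain x where x: "x \<in> X" using not_empty space_\<xi> by blast
  have "prob_space (return (count_space {1..n}) (1::nat))"
    using assms by (intro prob_space_return) simp
  then show ?thesis
    using label_law_image_in_finite_measures(2)[of "return (count_space {1..n}) 1" n "\<lambda>_. x" "top_of_set X"] x
    by fastforce
qed

lemma q_GW_le_q_W:
  assumes "n \<ge> 1"
  shows "q_GW n (top_of_set X, inner, \<xi>)
    \<le> ennreal (sqrt (2 * lambda_max (moment_matrix \<xi>))) * q_W n (top_of_set X) \<xi>"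
  unfolding q_W_def
proof (rule le_ennreal_mult_INF[OF finite_measures_nonempty[OF assms]])
  fix \<nu> assume \<nu>: "\<nu> \<in> finite_measures n (top_of_set X)"
  show "q_GW n (top_of_set X, inner, \<xi>) \<le> ennreal (sqrt (2 * lambda_max (moment_matrix \<xi>))) * W2 \<xi> \<nu>"
    unfolding W2_def
    by (rule le_ennreal_mult_INF[OF couplings_nonempty[OF prob_space_\<xi> finite_measures_prob_space[OF \<nu>]]])
      (use q_GW_le_transport_cost[OF assms \<nu>] in simp_all)
qed simp

end

theorem theorem4p5:
  fixes X :: "(real^'d) set" and \<xi> :: "(real^'d) measure" and n :: nat
  assumes "closed X" and "convex X"
    and "gm_space (top_of_set X, inner, \<xi>)"
    and "n \<ge> 1"
  shows "ennreal (sqrt (lambda_min (moment_matrix \<xi>))) * q_W n (top_of_set X) \<xi>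
           \<le> q_GW n (top_of_set X, inner, \<xi>)
       \<and> q_GW n (top_of_set X, inner, \<xi>)
           \<le> ennreal (sqrt (2 * lambda_max (moment_matrix \<xi>))) * q_W n (top_of_set X) \<xi>"
proof
  interpret scalar_product_gm_space X \<xi> by unfold_locales fact
  show "ennreal (sqrt (lambda_min (moment_matrix \<xi>))) * q_W n (top_of_set X) \<xi>
      \<le> q_GW n (top_of_set X, inner, \<xi>)"
    unfolding q_GW_def
  proof (rule INF_greatest)
    fix \<Y> assume "\<Y> \<in> GM n"
    then obtain G \<upsilon> where "\<Y> = (discrete_topology {1..n}, G, \<upsilon>)" "gm_space \<Y>"
      by (auto simp: GM_def)
    then show "ennreal (sqrt (lambda_min (moment_matrix \<xi>))) * q_W n (top_of_set X) \<xi>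
        \<le> GW2 (top_of_set X, inner, \<xi>) \<Y>"
      using q_W_le_GW2[OF assms(1,2)] by simp
  qed
  show "q_GW n (top_of_set X, inner, \<xi>)
      \<le> ennreal (sqrt (2 * lambda_max (moment_matrix \<xi>))) * q_W n (top_of_set X) \<xi>"
    by (rule q_GW_le_q_W[OF \<open>n \<ge> 1\<close>])
qed

end
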